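(* Let $S$ be the one-sided full $2$-shift on $\Sigma_+=\{0,1\}^{\mathbb{N}}$ with the uniform Bernoulli measure $\mu_+$, let $V_S$ be its Perron-Frobenius operator on $L^2(\Sigma_+,\mu_+)$, and let $X=\mathbb{C}[h]$ with $h(\omega)=\sum_{i\ge1}\omega_i2^{-i}$. For any $f\in X$, $$V_S^kf\to\int_{\Sigma_+}f\,d\mu_+\cdot\Phi_0\quad\text{in } X\text{ as }k\to\infty,$$ where $\Phi_0\equiv1$.
   Context: $\Sigma_+$ has elements $\omega=(\omega_1,\omega_2,\dots)$; $(S\omega)_j=\omega_{j+1}$; $\mu_+=\mu_0^{\otimes\mathbb{N}}$ with $\mu_0(\{0\})=\mu_0(\{1\})=1/2$. The Koopman operator on $L^2(\Sigma_+,\mu_+)$ is $(U_Sf)(\omega)=f(S\omega)$ and $V_S=U_S^*$. $X=\varinjlim X_n$, $X_n=\sum_{i=0}^n\mathbb{C}h^i$ (finite-dimensional with usual topology), with the inductive limit topology; $V_S$ maps each $X_n$ into itself. *)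

theory Defs
  imports "HOL-Probability.Probability"
begin

section \<open>The one-sided full 2-shift\<close>

text \<open>The alphabet \<open>{0, 1}\<close> is \<^typ>\<open>bool\<close>, with \<open>True\<close> for the symbol \<open>1\<close>; the symbol
  \<open>\<omega>\<^sub>i\<close> with \<open>i \<ge> 1\<close> is \<open>\<omega> (i - 1)\<close>.\<close>

type_synonym seq = "nat \<Rightarrow> bool"

definition shift_map :: "seq \<Rightarrow> seq" where
  "shift_map \<omega> = (\<lambda>j. \<omega> (Suc j))"

definition mu :: "seq measure" where
  "mu = PiM UNIV (\<lambda>_. measure_pmf (bernoulli_pmf (1 / 2)))"

text \<open>\<open>h(\<omega>) = \<Sum>\<^sub>i\<^sub>\<ge>\<^sub>1 \<omega>\<^sub>i 2\<^sup>-\<^sup>i\<close>, reindexed from \<open>0\<close>.\<close>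

definition h :: "seq \<Rightarrow> real" where
  "h \<omega> = (\<Sum>i. of_bool (\<omega> i) / 2 ^ Suc i)"

lemma space_mu [simp]: "space mu = UNIV"
  by (simp add: mu_def space_PiM)

interpretation mu: prob_space mu
  unfolding mu_def by (intro prob_space_PiM measure_pmf.prob_space_axioms)

lemma sets_mu: "sets mu = sets (PiM UNIV (\<lambda>_. count_space UNIV))"
  unfolding mu_def by (intro sets_PiM_cong) auto

lemma measurable_coord [measurable]: "(\<lambda>\<omega>. \<omega> i) \<in> measurable mu (count_space UNIV)"
  by (simp add: measurable_cong_sets[OF sets_mu refl])

lemma distr_shift: "distr mu mu shift_map = mu"
  using distr_PiM_reindex[of UNIV "\<lambda>_. measure_pmf (bernoulli_pmf (1 / 2))" Suc UNIV]
  by (simp add: mu_def shift_map_def[abs_def] measure_pmf.prob_space_axioms restrict_UNIV)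

lemma measurable_shift_map [measurable]: "shift_map \<in> measurable mu mu"
proof -
  have "shift_map \<in> measurable mu (PiM UNIV (\<lambda>_. measure_pmf (bernoulli_pmf (1 / 2))))"
    by (rule measurable_PiM_single') (auto simp: shift_map_def space_PiM)
  then show ?thesis by (simp add: mu_def)
qed

lemma AE_shift: "AE \<omega> in mu. P \<omega> \<Longrightarrow> AE \<omega> in mu. P (shift_map \<omega>)"
  by (rule AE_distrD[OF measurable_shift_map]) (simp only: distr_shift)

lemma measurable_h [measurable]: "h \<in> borel_measurable mu"
  unfolding h_def[abs_def] by measurable

lemma summable_h: "summable (\<lambda>i. of_bool (\<omega> i) / 2 ^ Suc i :: real)"
proof (rule summable_comparison_test')
  show "summable (\<lambda>i. (1 / 2) ^ i :: real)" by (rule summable_geometric) simp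
  show "norm (of_bool (\<omega> i) / 2 ^ Suc i :: real) \<le> (1 / 2) ^ i" for i
    by (simp add: power_divide field_simps)
qed

lemma h_nonneg: "0 \<le> h \<omega>"
  unfolding h_def by (intro suminf_nonneg summable_h) auto

lemma h_le_1: "h \<omega> \<le> 1"
proof -
  have "h \<omega> \<le> (\<Sum>i. (1 / 2) ^ Suc i)"
    unfolding h_def
    by (intro suminf_le summable_h sums_summable[OF power_half_series]) (auto simp: power_divide)
  also have "\<dots> = 1" using power_half_series by (rule sums_unique[symmetric])
  finally show ?thesis .
qed


section \<open>The complex Hilbert space of square-integrable functions modulo null sets\<close>

definition sq_integrable :: "(seq \<Rightarrow> complex) \<Rightarrow> bool" where
  "sq_integrable f \<longleftrightarrow> f \<in> borel_measurable mu \<and> integrable mu (\<lambda>\<omega>. (cmod (f \<omega>))\<^sup>2)"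

definition L2_rel :: "(seq \<Rightarrow> complex) \<Rightarrow> (seq \<Rightarrow> complex) \<Rightarrow> bool" where
  "L2_rel f g \<longleftrightarrow> sq_integrable f \<and> sq_integrable g \<and> (AE \<omega> in mu. f \<omega> = g \<omega>)"

lemma sq_integrable_measurable [measurable_dest]: "sq_integrable f \<Longrightarrow> f \<in> borel_measurable mu"
  by (simp add: sq_integrable_def)

lemma sq_integrable_mult:
  assumes [measurable]: "f \<in> borel_measurable mu" "g \<in> borel_measurable mu"
    and "integrable mu (\<lambda>\<omega>. (cmod (f \<omega>))\<^sup>2)" "integrable mu (\<lambda>\<omega>. (cmod (g \<omega>))\<^sup>2)"
  shows "integrable mu (\<lambda>\<omega>. f \<omega> * g \<omega>)"
proof (rule Bochner_Integration.integrable_bound)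
  show "integrable mu (\<lambda>\<omega>. (cmod (f \<omega>))\<^sup>2 + (cmod (g \<omega>))\<^sup>2)" using assms by auto
  have "a * b \<le> a\<^sup>2 + b\<^sup>2" if "0 \<le> a" "0 \<le> b" for a b :: real
  proof -
    have "0 \<le> a * b" using that by simp
    then show ?thesis using sum_squares_bound[of a b] by linarith
  qed
  then show "AE \<omega> in mu. cmod (f \<omega> * g \<omega>) \<le> norm ((cmod (f \<omega>))\<^sup>2 + (cmod (g \<omega>))\<^sup>2)"
    by (auto simp: norm_mult)
qed measurable

lemma borel_measurable_cnj [measurable]:
  "f \<in> borel_measurable M \<Longrightarrow> (\<lambda>x. cnj (f x)) \<in> borel_measurable M"
  by (rule borel_measurable_continuous_on[of cnj]) (auto intro: continuous_intros)

lemma sq_integrable_mult_cnj: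
  assumes "sq_integrable f" "sq_integrable g"
  shows "integrable mu (\<lambda>\<omega>. f \<omega> * cnj (g \<omega>))"
  using assms by (intro sq_integrable_mult) (auto simp: sq_integrable_def)

lemma sq_integrable_zero: "sq_integrable (\<lambda>_. 0)"
  by (simp add: sq_integrable_def)

lemma sq_integrable_cmult: "sq_integrable f \<Longrightarrow> sq_integrable (\<lambda>\<omega>. c * f \<omega>)"
  by (auto simp: sq_integrable_def norm_mult power_mult_distrib)

lemma sq_integrable_add:
  assumes "sq_integrable f" "sq_integrable g"
  shows "sq_integrable (\<lambda>\<omega>. f \<omega> + g \<omega>)"
proof -
  have m [measurable]: "f \<in> borel_measurable mu" "g \<in> borel_measurable mu"
    using assms by (auto simp: sq_integrable_def)
  have "(cmod (a + b))\<^sup>2 \<le> 2 * (cmod a)\<^sup>2 + 2 * (cmod b)\<^sup>2" for a b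
  proof -
    have "(cmod (a + b))\<^sup>2 \<le> (cmod a + cmod b)\<^sup>2"
      by (intro power_mono norm_triangle_ineq) auto
    also have "\<dots> \<le> 2 * (cmod a)\<^sup>2 + 2 * (cmod b)\<^sup>2"
      using sum_squares_bound[of "cmod a" "cmod b"] by (simp add: power2_sum)
    finally show ?thesis .
  qed
  note bound = this
  have "integrable mu (\<lambda>\<omega>. (cmod (f \<omega> + g \<omega>))\<^sup>2)"
  proof (rule Bochner_Integration.integrable_bound)
    show "integrable mu (\<lambda>\<omega>. 2 * (cmod (f \<omega>))\<^sup>2 + 2 * (cmod (g \<omega>))\<^sup>2)"
      using assms by (simp add: sq_integrable_def)
    show "AE \<omega> in mu. norm ((cmod (f \<omega> + g \<omega>))\<^sup>2)
        \<le> norm (2 * (cmod (f \<omega>))\<^sup>2 + 2 * (cmod (g \<omega>))\<^sup>2)"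
      using bound by (intro AE_I2) simp
  qed measurable
  then show ?thesis by (simp add: sq_integrable_def)
qed

lemma sq_integrable_shift:
  assumes "sq_integrable f"
  shows "sq_integrable (\<lambda>\<omega>. f (shift_map \<omega>))"
proof -
  have [measurable]: "f \<in> borel_measurable mu" using assms by (simp add: sq_integrable_def)
  have "integrable mu (\<lambda>\<omega>. (cmod (f (shift_map \<omega>)))\<^sup>2)"
    using assms integrable_distr_eq[of shift_map mu mu "\<lambda>\<omega>. (cmod (f \<omega>))\<^sup>2"]
    by (simp add: distr_shift sq_integrable_def)
  then show ?thesis by (simp add: sq_integrable_def)
qed

lemma sq_integrable_h_power: "sq_integrable (\<lambda>\<omega>. complex_of_real (h \<omega>) ^ i)"
proof -
  have "integrable mu (\<lambda>\<omega>. (cmod (complex_of_real (h \<omega>) ^ i))\<^sup>2)"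
  proof (rule mu.integrable_const_bound[of _ 1])
    show "AE \<omega> in mu. norm ((cmod (complex_of_real (h \<omega>) ^ i))\<^sup>2) \<le> 1"
      by (auto simp: norm_power h_nonneg h_le_1 intro!: power_le_one)
  qed measurable
  then show ?thesis by (simp add: sq_integrable_def)
qed

quotient_type L2 = "seq \<Rightarrow> complex" / partial: L2_rel
proof (rule part_equivpI)
  show "\<exists>f. L2_rel f f" using sq_integrable_zero by (auto simp: L2_rel_def)
  show "symp L2_rel" by (auto simp: symp_def L2_rel_def)
  show "transp L2_rel" unfolding transp_def L2_rel_def by fastforce
qed

lift_definition cinner :: "L2 \<Rightarrow> L2 \<Rightarrow> complex" is
  "\<lambda>f g. \<integral>\<omega>. f \<omega> * cnj (g \<omega>) \<partial>mu"
  unfolding L2_rel_def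
proof -
  fix f g f' g'
  assume L: "sq_integrable f \<and> sq_integrable g \<and> (AE \<omega> in mu. f \<omega> = g \<omega>)"
    "sq_integrable f' \<and> sq_integrable g' \<and> (AE \<omega> in mu. f' \<omega> = g' \<omega>)"
  then have [measurable]: "f \<in> borel_measurable mu" "g \<in> borel_measurable mu"
    "f' \<in> borel_measurable mu" "g' \<in> borel_measurable mu"
    by (simp_all add: sq_integrable_def)
  have "AE \<omega> in mu. f \<omega> * cnj (f' \<omega>) = g \<omega> * cnj (g' \<omega>)" using L by fastforce
  then show "(\<integral>\<omega>. f \<omega> * cnj (f' \<omega>) \<partial>mu) = (\<integral>\<omega>. g \<omega> * cnj (g' \<omega>) \<partial>mu)"
    by (intro integral_cong_AE) measurable
qed

lift_definition cscale :: "complex \<Rightarrow> L2 \<Rightarrow> L2" is "\<lambda>c f \<omega>. c * f \<omega>"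
proof -
  fix c :: complex and f g assume fg: "L2_rel f g"
  then have "AE \<omega> in mu. c * f \<omega> = c * g \<omega>" unfolding L2_rel_def by fastforce
  with fg show "L2_rel (\<lambda>\<omega>. c * f \<omega>) (\<lambda>\<omega>. c * g \<omega>)"
    by (simp add: L2_rel_def sq_integrable_cmult)
qed

lift_definition L2_integral :: "L2 \<Rightarrow> complex" is "\<lambda>f. \<integral>\<omega>. f \<omega> \<partial>mu"
  by (rule integral_cong_AE) (simp_all add: L2_rel_def sq_integrable_def)

instantiation L2 :: real_inner
begin

lift_definition zero_L2 :: L2 is "\<lambda>_. 0"
  by (simp add: L2_rel_def sq_integrable_zero)

lift_definition plus_L2 :: "L2 \<Rightarrow> L2 \<Rightarrow> L2" is "\<lambda>f g \<omega>. f \<omega> + g \<omega>"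
proof -
  fix f g f' g' assume L: "L2_rel f g" "L2_rel f' g'"
  then have "AE \<omega> in mu. f \<omega> + f' \<omega> = g \<omega> + g' \<omega>" unfolding L2_rel_def by fastforce
  with L show "L2_rel (\<lambda>\<omega>. f \<omega> + f' \<omega>) (\<lambda>\<omega>. g \<omega> + g' \<omega>)"
    by (simp add: L2_rel_def sq_integrable_add)
qed

definition uminus_L2 :: "L2 \<Rightarrow> L2" where "- f = cscale (- 1) f"

definition minus_L2 :: "L2 \<Rightarrow> L2 \<Rightarrow> L2" where "f - g = f + - (g :: L2)"

definition scaleR_L2 :: "real \<Rightarrow> L2 \<Rightarrow> L2" where "r *\<^sub>R f = cscale (complex_of_real r) f"

definition inner_L2 :: "L2 \<Rightarrow> L2 \<Rightarrow> real" where "inner f g = Re (cinner (f :: L2) g)"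

definition norm_L2 :: "L2 \<Rightarrow> real" where "norm (f :: L2) = sqrt (inner f f)"

definition dist_L2 :: "L2 \<Rightarrow> L2 \<Rightarrow> real" where "dist f g = norm (f - g :: L2)"

definition sgn_L2 :: "L2 \<Rightarrow> L2" where "sgn f = inverse (norm f) *\<^sub>R (f :: L2)"

definition uniformity_L2 :: "(L2 \<times> L2) filter" where
  "uniformity_L2 = (INF e\<in>{0 <..}. principal {(f, g). dist f g < e})"

definition open_L2 :: "L2 set \<Rightarrow> bool" where
  "open_L2 U = (\<forall>f\<in>U. eventually (\<lambda>(f', g). f' = f \<longrightarrow> g \<in> U) uniformity)"

instance
proof
  fix f g k :: L2 and r s :: real
  note rel = L2_rel_def sq_integrable_zero sq_integrable_add sq_integrable_cmult
  show "f + g + k = f + (g + k)" by transfer (simp add: rel add.assoc)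
  show "f + g = g + f" by transfer (simp add: rel add.commute)
  show "0 + f = f" by transfer (simp add: rel)
  show "- f + f = 0" unfolding uminus_L2_def by transfer (simp add: rel)
  show "f - g = f + - g" by (rule minus_L2_def)
  show "r *\<^sub>R (f + g) = r *\<^sub>R f + r *\<^sub>R g"
    unfolding scaleR_L2_def by transfer (simp add: rel distrib_left)
  show "(r + s) *\<^sub>R f = r *\<^sub>R f + s *\<^sub>R f"
    unfolding scaleR_L2_def by transfer (simp add: rel distrib_right)
  show "r *\<^sub>R s *\<^sub>R f = (r * s) *\<^sub>R f"
    unfolding scaleR_L2_def by transfer (simp add: rel mult.assoc)
  show "1 *\<^sub>R f = f" unfolding scaleR_L2_def by transfer (simp add: rel)
  show "sgn f = inverse (norm f) *\<^sub>R f" by (rule sgn_L2_def)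
  show "dist f g = norm (f - g)" by (rule dist_L2_def)
  show "(uniformity :: (L2 \<times> L2) filter) = (INF e\<in>{0 <..}. principal {(f, g). dist f g < e})"
    by (rule uniformity_L2_def)
  show "open U = (\<forall>f\<in>U. \<forall>\<^sub>F (f', g) in uniformity. f' = f \<longrightarrow> g \<in> U)" for U :: "L2 set"
    by (rule open_L2_def)
  show "inner f g = inner g f"
  proof -
    have "cinner f g = cnj (cinner g f)"
      by transfer (simp add: mult.commute flip: Bochner_Integration.integral_cnj)
    then show ?thesis by (simp add: inner_L2_def)
  qed
  show "inner (f + g) k = inner f k + inner g k"
  proof -
    have "cinner (f + g) k = cinner f k + cinner g k"
      by transfer (auto simp: L2_rel_def sq_integrable_mult_cnj distrib_right
          intro!: Bochner_Integration.integral_add)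
    then show ?thesis by (simp add: inner_L2_def)
  qed
  show "inner (r *\<^sub>R f) g = r * inner f g"
  proof -
    have "cinner (cscale c f) g = c * cinner f g" for c
      by transfer (simp add: mult.assoc)
    then show ?thesis by (simp add: inner_L2_def scaleR_L2_def)
  qed
  have self: "cinner f f = 0 \<longleftrightarrow> f = 0" "Im (cinner f f) = 0" "0 \<le> Re (cinner f f)"
  proof -
    have eq: "(\<integral>\<omega>. F \<omega> * cnj (F \<omega>) \<partial>mu) = complex_of_real (\<integral>\<omega>. (cmod (F \<omega>))\<^sup>2 \<partial>mu)" for F
      by (simp add: complex_norm_square[symmetric] del: of_real_power)
    show "Im (cinner f f) = 0" by transfer (simp add: eq)
    show "0 \<le> Re (cinner f f)" by transfer (simp add: eq)
    show "cinner f f = 0 \<longleftrightarrow> f = 0"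
    proof (transfer, unfold eq)
      fix F assume F: "L2_rel F F"
      then have "integrable mu (\<lambda>\<omega>. (cmod (F \<omega>))\<^sup>2)" by (simp add: L2_rel_def sq_integrable_def)
      then have "(\<integral>\<omega>. (cmod (F \<omega>))\<^sup>2 \<partial>mu) = 0 \<longleftrightarrow> (AE \<omega> in mu. (cmod (F \<omega>))\<^sup>2 = 0)"
        by (intro integral_nonneg_eq_0_iff_AE) auto
      with F show "(complex_of_real (\<integral>\<omega>. (cmod (F \<omega>))\<^sup>2 \<partial>mu) = 0) = L2_rel F (\<lambda>_. 0)"
        by (simp add: L2_rel_def sq_integrable_zero)
    qed
  qed
  show "0 \<le> inner f f" using self by (simp add: inner_L2_def)
  show "inner f f = 0 \<longleftrightarrow> f = 0" using self by (simp add: inner_L2_def complex_eq_iff)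
  show "norm f = sqrt (inner f f)" by (rule norm_L2_def)
qed

end


section \<open>Koopman and Perron-Frobenius operators\<close>

lift_definition U_S :: "L2 \<Rightarrow> L2" is "\<lambda>f \<omega>. f (shift_map \<omega>)"
proof -
  fix f g assume "L2_rel f g"
  then show "L2_rel (\<lambda>\<omega>. f (shift_map \<omega>)) (\<lambda>\<omega>. g (shift_map \<omega>))"
    using sq_integrable_shift[of f] sq_integrable_shift[of g] AE_shift[of "\<lambda>\<omega>. f \<omega> = g \<omega>"]
    by (simp add: L2_rel_def)
qed

text \<open>The Hilbert-space adjoint; \<^const>\<open>cinner\<close> is linear in its first argument.\<close>

definition cadjoint :: "(L2 \<Rightarrow> L2) \<Rightarrow> L2 \<Rightarrow> L2" where
  "cadjoint T = (THE T'. \<forall>f g. cinner (T' f) g = cinner f (T g))"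

definition V_S :: "L2 \<Rightarrow> L2" where
  "V_S = cadjoint U_S"


section \<open>The test-function space of polynomials in \<open>h\<close>\<close>

lift_definition h_pow :: "nat \<Rightarrow> L2" is "\<lambda>i \<omega>. complex_of_real (h \<omega>) ^ i"
  by (simp add: L2_rel_def sq_integrable_h_power)

lift_definition Phi0 :: L2 is "\<lambda>_. 1"
  using sq_integrable_h_power[of 0] by (simp add: L2_rel_def)

definition polyX_n :: "nat \<Rightarrow> L2 set" where
  "polyX_n n = {\<Sum>i\<le>n. cscale (c i) (h_pow i) | c. True}"

definition polyX :: "L2 set" where
  "polyX = (\<Union>n. polyX_n n)"

text \<open>Complex locally convex vector topologies on the subspace \<open>X\<close> (not necessarily Hausdorff).\<close>

definition locally_convex_topology :: "L2 set \<Rightarrow> L2 topology \<Rightarrow> bool" where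
  "locally_convex_topology X T \<longleftrightarrow>
     topspace T = X \<and>
     continuous_map (prod_topology T T) T (\<lambda>(f, g). f + g) \<and>
     continuous_map (prod_topology euclidean T) T (\<lambda>(c, f). cscale c f) \<and>
     (\<forall>W. openin T W \<and> 0 \<in> W \<longrightarrow> (\<exists>C. openin T C \<and> convex C \<and> 0 \<in> C \<and> C \<subseteq> W))"

text \<open>The inductive limit topology is the finest locally convex topology for which every inclusion
  of \<open>X\<^sub>n\<close> is continuous. It is formed here as the supremum of all locally convex topologies with
  this property; a supremum of locally convex topologies is again one. The usual topology of the
  finite-dimensional space \<open>X\<^sub>n\<close> is the one induced by the norm.\<close>

definition inductive_limit_topology :: "(nat \<Rightarrow> L2 set) \<Rightarrow> L2 topology" where
  "inductive_limit_topology Xn = topology_generated_by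
     {W. \<exists>T. locally_convex_topology (\<Union>n. Xn n) T \<and>
             (\<forall>n. continuous_map (top_of_set (Xn n)) T (\<lambda>f. f)) \<and> openin T W}"

definition polyX_topology :: "L2 topology" where
  "polyX_topology = inductive_limit_topology polyX_n"

end

theory Submission
  imports Defs "HOL-Computational_Algebra.Polynomial"
begin

text \<open>Up to null sets, \<open>V\<^sub>S\<close> averages over the two preimages of a point, so on \<open>p(h)\<close> it acts by
  \<open>p(x) \<mapsto> (p(x/2) + p((1 + x)/2)) / 2\<close>. This does not increase the degree, it preserves the
  integral and it halves the Lipschitz constant of \<open>p\<close> on the unit disc. Hence the iterates
  converge uniformly, and so in norm within a single \<open>X\<^sub>n\<close>, to the constant \<open>\<integral>f\<close>; continuity of
  the inclusion \<open>X\<^sub>n \<subseteq> X\<close> gives convergence in the inductive limit.\<close>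

section \<open>Splitting off the first symbol\<close>

abbreviation fair_coin :: "bool pmf" where
  "fair_coin \<equiv> bernoulli_pmf (1 / 2)"

text \<open>Self-similarity of the Bernoulli measure: the first symbol is a fair coin independent of
  the remaining sequence. All facts about the two preimages \<open>case_nat b \<omega>\<close> of
  \<open>\<omega>\<close> under the shift come from here.\<close>

lemma mu_eq_distr_case_nat: "mu = distr (measure_pmf fair_coin \<Otimes>\<^sub>M mu) mu (\<lambda>(b, \<omega>). case_nat b \<omega>)"
proof -
  interpret sequence_space "measure_pmf fair_coin" by standard
  show ?thesis using PiM_iter by (simp add: mu_def)
qed

lemma measurable_case_nat_pair [measurable]:
  "(\<lambda>(b, \<omega>). case_nat b \<omega>) \<in> measurable (measure_pmf fair_coin \<Otimes>\<^sub>M mu) mu"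
  unfolding mu_def by measurable

text \<open>Fubini for null sets gives the claim for almost every \<open>b\<close>. Both symbols
  have positive mass, so it holds for each \<open>b\<close>.\<close>

lemma AE_mu_case_nat:
  assumes "AE \<omega> in mu. P \<omega>"
  shows "AE \<omega> in mu. P (case_nat b \<omega>)"
proof -
  interpret pair_sigma_finite "measure_pmf fair_coin" mu ..
  have "AE x in measure_pmf fair_coin \<Otimes>\<^sub>M mu. P (case x of (b, \<omega>) \<Rightarrow> case_nat b \<omega>)"
    using assms by (intro AE_distrD[OF measurable_case_nat_pair]) (simp only: mu_eq_distr_case_nat[symmetric])
  then have "AE b in measure_pmf fair_coin. AE \<omega> in mu. P (case_nat b \<omega>)"
    by (auto dest: AE_pair)
  then show ?thesis by (simp add: AE_measure_pmf_iff set_pmf_bernoulli UNIV_bool) (cases b; simp)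
qed

text \<open>Fubini on the product of coin and sequence space; the outer integral over the coin is a
  sum of two terms of weight 1/2.\<close>

lemma
  fixes F :: "seq \<Rightarrow> complex"
  assumes F: "integrable mu F"
  shows integrable_mu_case_nat: "integrable mu (\<lambda>\<omega>. F (case_nat b \<omega>))"
    and integral_mu_case_nat: "(\<integral>\<omega>. F \<omega> \<partial>mu) =
      ((\<integral>\<omega>. F (case_nat False \<omega>) \<partial>mu) + (\<integral>\<omega>. F (case_nat True \<omega>) \<partial>mu)) / 2"
proof -
  interpret pair_sigma_finite "measure_pmf fair_coin" mu ..
  have [measurable]: "F \<in> borel_measurable mu" using F by auto
  have "integrable (distr (measure_pmf fair_coin \<Otimes>\<^sub>M mu) mu (\<lambda>(b, \<omega>). case_nat b \<omega>)) F"
    using F by (simp only: mu_eq_distr_case_nat[symmetric])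
  then have int: "integrable (measure_pmf fair_coin \<Otimes>\<^sub>M mu) (\<lambda>(b, \<omega>). F (case_nat b \<omega>))"
    by (subst (asm) integrable_distr_eq) (auto simp: case_prod_unfold)
  show "integrable mu (\<lambda>\<omega>. F (case_nat b \<omega>))"
    using AE_integrable_fst[OF int]
    by (simp add: AE_measure_pmf_iff set_pmf_bernoulli UNIV_bool) (cases b; simp)
  have "(\<integral>\<omega>. F \<omega> \<partial>mu) = (\<integral>x. F (case x of (b, \<omega>) \<Rightarrow> case_nat b \<omega>) \<partial>(measure_pmf fair_coin \<Otimes>\<^sub>M mu))"
    by (subst mu_eq_distr_case_nat, subst integral_distr) auto
  also have "\<dots> = (\<integral>b. \<integral>\<omega>. F (case_nat b \<omega>) \<partial>mu \<partial>measure_pmf fair_coin)"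
    using integral_fst'[OF int] by (simp add: case_prod_unfold)
  finally show "(\<integral>\<omega>. F \<omega> \<partial>mu) =
      ((\<integral>\<omega>. F (case_nat False \<omega>) \<partial>mu) + (\<integral>\<omega>. F (case_nat True \<omega>) \<partial>mu)) / 2"
    by (subst (asm) integral_measure_pmf[of UNIV]) (auto simp: UNIV_bool scaleR_conv_of_real field_simps)
qed

lemma sq_integrable_case_nat:
  assumes "sq_integrable F"
  shows "sq_integrable (\<lambda>\<omega>. F (case_nat b \<omega>))"
proof -
  have [measurable]: "F \<in> borel_measurable mu" using assms by auto
  \<comment> \<open>The branch lemma is about complex-valued integrands, so the squared modulus is
    written as a product with the conjugate.\<close>
  have "integrable mu (\<lambda>\<omega>. F \<omega> * cnj (F \<omega>))"
    using assms by (intro sq_integrable_mult_cnj)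
  then have "integrable mu (\<lambda>\<omega>. F (case_nat b \<omega>) * cnj (F (case_nat b \<omega>)))"
    by (rule integrable_mu_case_nat)
  then have "integrable mu (\<lambda>\<omega>. complex_of_real ((cmod (F (case_nat b \<omega>)))\<^sup>2))"
    by (simp only: complex_norm_square)
  then show ?thesis by (simp add: sq_integrable_def complex_of_real_integrable_eq del: of_real_power)
qed

text \<open>A new leading binary digit moves the other digits one place to the right. The resulting
  maps x/2 and (1 + x)/2 are the inverse branches of the doubling map.\<close>

lemma h_case_nat: "h (case_nat b \<omega>) = (of_bool b + h \<omega>) / 2"
proof -
  have "h (case_nat b \<omega>) = of_bool b / 2 + (\<Sum>i. of_bool (\<omega> i) / 2 ^ Suc (Suc i))"
    unfolding h_def using suminf_split_head[OF summable_h[of "case_nat b \<omega>"]] by simp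
  also have "(\<Sum>i. of_bool (\<omega> i) / 2 ^ Suc (Suc i)) = h \<omega> / 2"
    unfolding h_def using suminf_divide[OF summable_h[of \<omega>], of 2] by (simp add: mult.commute)
  finally show ?thesis by (simp add: add_divide_distrib)
qed


section \<open>The Perron-Frobenius operator as an average over preimages\<close>

text \<open>Candidate for the adjoint of \<open>U_S\<close>. The factor 1/2 stands on the left to
  match \<open>sq_integrable_cmult\<close>.\<close>

lift_definition preimage_avg :: "L2 \<Rightarrow> L2" is
  "\<lambda>F \<omega>. 1 / 2 * (F (case_nat False \<omega>) + F (case_nat True \<omega>))"
proof -
  fix F G assume FG: "L2_rel F G"
  then have "AE \<omega> in mu. F (case_nat b \<omega>) = G (case_nat b \<omega>)" for b
    by (intro AE_mu_case_nat) (simp add: L2_rel_def)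
  from this[of False] this[of True]
  have "AE \<omega> in mu. 1 / 2 * (F (case_nat False \<omega>) + F (case_nat True \<omega>)) =
      1 / 2 * (G (case_nat False \<omega>) + G (case_nat True \<omega>))"
    by eventually_elim simp
  with FG show "L2_rel (\<lambda>\<omega>. 1 / 2 * (F (case_nat False \<omega>) + F (case_nat True \<omega>)))
      (\<lambda>\<omega>. 1 / 2 * (G (case_nat False \<omega>) + G (case_nat True \<omega>)))"
    unfolding L2_rel_def
    by (intro conjI sq_integrable_cmult sq_integrable_add sq_integrable_case_nat) auto
qed

text \<open>Splitting off the first symbol in the integral on the right leaves the argument of
  \<open>G\<close> equal to \<open>\<omega>\<close> on both branches.\<close>

lemma cinner_preimage_avg: "cinner (preimage_avg f) g = cinner f (U_S g)"
proof transfer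
  fix F G assume "L2_rel F F" "L2_rel G G"
  then have sq: "sq_integrable F" "sq_integrable G" by (auto simp: L2_rel_def)
  have shift: "shift_map (case_nat b \<omega>) = \<omega>" for b \<omega>
    by (simp add: shift_map_def)
  have int: "integrable mu (\<lambda>\<omega>. F (case_nat b \<omega>) * cnj (G \<omega>))" for b
    using sq by (intro sq_integrable_mult_cnj sq_integrable_case_nat)
  have "(\<integral>\<omega>. F \<omega> * cnj (G (shift_map \<omega>)) \<partial>mu) =
     ((\<integral>\<omega>. F (case_nat False \<omega>) * cnj (G \<omega>) \<partial>mu) + (\<integral>\<omega>. F (case_nat True \<omega>) * cnj (G \<omega>) \<partial>mu)) / 2"
    using integral_mu_case_nat[OF sq_integrable_mult_cnj[OF sq(1) sq_integrable_shift[OF sq(2)]]]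
    by (simp add: shift)
  also have "\<dots> = (\<integral>\<omega>. 1 / 2 * (F (case_nat False \<omega>) + F (case_nat True \<omega>)) * cnj (G \<omega>) \<partial>mu)"
    using int by (simp add: distrib_right mult.assoc add_divide_distrib)
  finally show "(\<integral>\<omega>. 1 / 2 * (F (case_nat False \<omega>) + F (case_nat True \<omega>)) * cnj (G \<omega>) \<partial>mu) =
      (\<integral>\<omega>. F \<omega> * cnj (G (shift_map \<omega>)) \<partial>mu)" by simp
qed

lemma cinner_eqI:
  assumes "\<And>g. cinner f g = cinner f' g"
  shows "f = f'"
proof -
  have "inner f g = inner f' g" for g using assms by (simp add: inner_L2_def)
  then show ?thesis by (metis vector_eq_rdot)
qed

text \<open>\<open>cadjoint\<close> is a definite description: existence is the adjoint identity
  above, uniqueness is nondegeneracy of the inner product.\<close>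

lemma V_S_eq_preimage_avg: "V_S = preimage_avg"
  unfolding V_S_def cadjoint_def
  by (rule the_equality) (auto simp: cinner_preimage_avg intro!: ext cinner_eqI)


section \<open>Polynomials in \<open>h\<close>\<close>

lemma of_real_h_in_cball: "complex_of_real (h \<omega>) \<in> cball 0 1"
  using h_nonneg[of \<omega>] h_le_1[of \<omega>] by simp

lemma bounded_poly_cball:
  fixes p :: "complex poly"
  obtains B where "0 \<le> B" "\<And>z. z \<in> cball 0 1 \<Longrightarrow> cmod (poly p z) \<le> B"
proof -
  have "compact (poly p ` cball 0 1)"
    by (intro compact_continuous_image continuous_intros) auto
  then have "bounded (poly p ` cball 0 1)" by (rule compact_imp_bounded)
  then obtain B where "0 < B" "\<forall>w \<in> poly p ` cball 0 1. cmod w \<le> B"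
    unfolding bounded_pos by blast
  then show thesis by (intro that[of B]) auto
qed

lemma measurable_poly_h [measurable]: "(\<lambda>\<omega>. poly p (complex_of_real (h \<omega>))) \<in> borel_measurable mu"
  by (rule borel_measurable_continuous_on[of "poly p"]) (auto intro: continuous_intros)

lemma sq_integrable_bounded:
  assumes [measurable]: "F \<in> borel_measurable mu" and B: "\<And>\<omega>. cmod (F \<omega>) \<le> B"
  shows "sq_integrable F"
proof -
  have "integrable mu (\<lambda>\<omega>. (cmod (F \<omega>))\<^sup>2)"
    by (rule mu.integrable_const_bound[of _ "B\<^sup>2"]) (auto intro!: power_mono B)
  then show ?thesis by (simp add: sq_integrable_def)
qed

lemma sq_integrable_const: "sq_integrable (\<lambda>_. c)"
  by (rule sq_integrable_bounded) auto

lemma sq_integrable_poly_h: "sq_integrable (\<lambda>\<omega>. poly p (complex_of_real (h \<omega>)))"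
proof -
  obtain B where "\<And>z. z \<in> cball 0 1 \<Longrightarrow> cmod (poly p z) \<le> B" using bounded_poly_cball by blast
  then show ?thesis
    by (intro sq_integrable_bounded[of _ B] measurable_poly_h) (metis of_real_h_in_cball)
qed

text \<open>Polynomials serve as representatives of elements of \<open>polyX\<close>, so that
  degrees and Lipschitz constants can be spoken of.\<close>

lift_definition poly_h :: "complex poly \<Rightarrow> L2" is "\<lambda>p \<omega>. poly p (complex_of_real (h \<omega>))"
  by (simp add: L2_rel_def sq_integrable_poly_h)

text \<open>Otherwise \<open>transfer\<close> would replace polynomials by their coefficient sequences.\<close>

declare smult.transfer [transfer_rule del] monom.transfer [transfer_rule del]
  pCons.transfer [transfer_rule del]

lemma poly_h_add: "poly_h (p + q) = poly_h p + poly_h q"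
  by transfer (simp add: L2_rel_def sq_integrable_add sq_integrable_poly_h)

lemma poly_h_smult: "poly_h (smult c p) = cscale c (poly_h p)"
  by transfer (simp add: L2_rel_def sq_integrable_cmult sq_integrable_poly_h)

lemma poly_h_monom: "poly_h (monom c i) = cscale c (h_pow i)"
  by transfer (simp add: L2_rel_def sq_integrable_cmult sq_integrable_h_power poly_monom)

lemma poly_h_const: "poly_h [:c:] = cscale c Phi0"
  by transfer (simp add: L2_rel_def sq_integrable_const)

lemma poly_h_diff: "poly_h (p - q) = poly_h p - poly_h q"
  using poly_h_add[of "p - q" q] by simp

lemma poly_h_0: "poly_h 0 = 0"
  using poly_h_diff[of 0 0] by simp

lemma poly_h_sum: "finite A \<Longrightarrow> poly_h (\<Sum>i\<in>A. P i) = (\<Sum>i\<in>A. poly_h (P i))"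
  by (induction rule: finite_induct) (auto simp: poly_h_0 poly_h_add)

lemma polyX_n_eq: "polyX_n n = poly_h ` {p. degree p \<le> n}"
proof (intro equalityI subsetI)
  fix f assume "f \<in> polyX_n n"
  then obtain c where "f = poly_h (\<Sum>i\<le>n. monom (c i) i)"
    by (auto simp: polyX_n_def poly_h_sum poly_h_monom)
  moreover have "degree (\<Sum>i\<le>n. monom (c i) i) \<le> n"
    by (intro degree_sum_le) (auto intro: order_trans[OF degree_monom_le])
  ultimately show "f \<in> poly_h ` {p. degree p \<le> n}" by blast
next
  fix f assume "f \<in> poly_h ` {p. degree p \<le> n}"
  then obtain p where p: "degree p \<le> n" "f = poly_h p" by blast
  then have "f = (\<Sum>i\<le>n. cscale (coeff p i) (h_pow i))"
    using poly_as_sum_of_monoms'[of p n] poly_h_sum[of "{..n}" "\<lambda>i. monom (coeff p i) i"]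
    by (simp add: poly_h_monom)
  then show "f \<in> polyX_n n" by (auto simp: polyX_n_def)
qed

lemma polyX_eq: "polyX = range poly_h"
  by (auto simp: polyX_def polyX_n_eq)

text \<open>The two linear polynomials are the inverse branches x/2 and (1 + x)/2.\<close>

definition avg_poly :: "complex poly \<Rightarrow> complex poly" where
  "avg_poly p = smult (1 / 2) (pcompose p [:0, 1 / 2:] + pcompose p [:1 / 2, 1 / 2:])"

lemma poly_avg_poly: "poly (avg_poly p) z = 1 / 2 * (poly p (z / 2) + poly p ((1 + z) / 2))"
  by (simp add: avg_poly_def poly_pcompose add_divide_distrib)

text \<open>Composition with a linear polynomial does not raise the degree. Hence \<open>V_S\<close>
  maps each \<open>polyX_n n\<close> into itself.\<close>

lemma degree_avg_poly_le: "degree (avg_poly p) \<le> degree p"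
  unfolding avg_poly_def
  by (intro order_trans[OF degree_smult_le] degree_add_le order_trans[OF degree_pcompose_le]) auto

lemma V_S_poly_h: "V_S (poly_h p) = poly_h (avg_poly p)"
  unfolding V_S_eq_preimage_avg
proof transfer
  fix p
  have "(\<lambda>\<omega>. 1 / 2 * (poly p (complex_of_real (h (case_nat False \<omega>))) +
      poly p (complex_of_real (h (case_nat True \<omega>))))) =
      (\<lambda>\<omega>. poly (avg_poly p) (complex_of_real (h \<omega>)))"
    by (simp add: poly_avg_poly h_case_nat)
  then show "L2_rel (\<lambda>\<omega>. 1 / 2 * (poly p (complex_of_real (h (case_nat False \<omega>))) +
      poly p (complex_of_real (h (case_nat True \<omega>)))))
      (\<lambda>\<omega>. poly (avg_poly p) (complex_of_real (h \<omega>)))"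
    by (simp add: L2_rel_def sq_integrable_poly_h)
qed

lemma V_S_funpow_poly_h: "(V_S ^^ k) (poly_h p) = poly_h ((avg_poly ^^ k) p)"
  by (induction k) (auto simp: V_S_poly_h)

lemma degree_avg_poly_funpow_le: "degree ((avg_poly ^^ k) p) \<le> degree p"
  by (induction k) (auto intro: order_trans[OF degree_avg_poly_le])

text \<open>The integral is the inner product with \<open>Phi0\<close>, and \<open>U_S\<close> fixes
  \<open>Phi0\<close>; the adjoint identity moves \<open>V_S\<close> over.\<close>

lemma L2_integral_V_S: "L2_integral (V_S f) = L2_integral f"
proof -
  have "U_S Phi0 = Phi0"
    by transfer (simp add: L2_rel_def sq_integrable_const)
  moreover have "L2_integral g = cinner g Phi0" for g by transfer simp
  ultimately show ?thesis by (simp add: V_S_eq_preimage_avg cinner_preimage_avg)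
qed

lemma L2_integral_V_S_funpow: "L2_integral ((V_S ^^ k) f) = L2_integral f"
  by (induction k) (auto simp: L2_integral_V_S)


section \<open>Convergence in norm\<close>

text \<open>Mean value inequality on the convex disc, where the derivative is bounded by
  compactness.\<close>

lemma lipschitz_poly_cball:
  fixes p :: "complex poly"
  obtains L where "L-lipschitz_on (cball 0 1) (poly p)"
proof -
  obtain B where B: "0 \<le> B" "\<And>z. z \<in> cball 0 1 \<Longrightarrow> cmod (poly (pderiv p) z) \<le> B"
    using bounded_poly_cball by blast
  have "cmod (poly p x - poly p y) \<le> B * cmod (x - y)" if "x \<in> cball 0 1" "y \<in> cball 0 1" for x y
    by (rule field_differentiable_bound[OF convex_cball _ B(2) that])
       (auto intro: has_field_derivative_at_within poly_DERIV)
  then have "B-lipschitz_on (cball 0 1) (poly p)"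
    using B(1) by (intro lipschitz_onI) (auto simp: dist_norm)
  then show thesis by (rule that)
qed

text \<open>Both inverse branches map the disc into itself and halve distances; averaging two
  functions with the same Lipschitz constant preserves that constant.\<close>

lemma lipschitz_avg_poly:
  assumes L: "L-lipschitz_on (cball 0 1) (poly p)"
  shows "(L / 2)-lipschitz_on (cball 0 1) (poly (avg_poly p))"
proof (rule lipschitz_onI)
  show "0 \<le> L / 2" using lipschitz_on_nonneg[OF L] by simp
  fix x y :: complex assume xy: "x \<in> cball 0 1" "y \<in> cball 0 1"
  \<comment> \<open>The choices \<open>c = 0\<close> and \<open>c = 1\<close> give the two
    branches.\<close>
  have half: "(c + z) / 2 \<in> cball 0 1" if "z \<in> cball 0 1" "cmod c \<le> 1" for c z :: complex
    using that norm_triangle_ineq[of c z] by (simp add: norm_divide)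
  have dist: "dist (poly p ((c + x) / 2)) (poly p ((c + y) / 2)) \<le> L * (dist x y / 2)"
    if "cmod c \<le> 1" for c
  proof -
    have "dist ((c + x) / 2) ((c + y) / 2) = dist x y / 2"
      by (simp add: dist_norm norm_divide flip: diff_divide_distrib)
    with lipschitz_onD[OF L half[OF xy(1) that] half[OF xy(2) that]] show ?thesis by simp
  qed
  have "dist (poly (avg_poly p) x) (poly (avg_poly p) y) =
      dist (poly p (x / 2) + poly p ((1 + x) / 2)) (poly p (y / 2) + poly p ((1 + y) / 2)) / 2"
    unfolding poly_avg_poly dist_norm right_diff_distrib[symmetric] norm_mult by simp
  also have "\<dots> \<le> (L * (dist x y / 2) + L * (dist x y / 2)) / 2"
    using dist[of 0] dist[of 1]
    by (intro divide_right_mono order_trans[OF dist_triangle_add] add_mono) auto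
  finally show "dist (poly (avg_poly p) x) (poly (avg_poly p) y) \<le> L / 2 * dist x y" by simp
qed

text \<open>On a probability space the norm in L2 is at most the supremum norm.\<close>

lemma norm_poly_h_le:
  assumes "\<And>\<omega>. cmod (poly p (complex_of_real (h \<omega>))) \<le> B"
  shows "norm (poly_h p) \<le> B"
proof -
  have B: "0 \<le> B" using assms[of undefined] norm_ge_zero order_trans by blast
  have "(norm (poly_h p))\<^sup>2 = Re (cinner (poly_h p) (poly_h p))"
    by (simp add: power2_norm_eq_inner inner_L2_def)
  also have "cinner (poly_h p) (poly_h p) =
      (\<integral>\<omega>. complex_of_real ((cmod (poly p (complex_of_real (h \<omega>))))\<^sup>2) \<partial>mu)"
    by transfer (simp only: complex_norm_square)
  also have "Re \<dots> = (\<integral>\<omega>. (cmod (poly p (complex_of_real (h \<omega>))))\<^sup>2 \<partial>mu)"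
    by (simp del: of_real_power)
  also have "\<dots> \<le> B\<^sup>2"
    using sq_integrable_poly_h[of p] assms
    by (intro mu.integral_le_const) (auto simp: sq_integrable_def intro!: power_mono)
  finally show ?thesis using B by (rule power2_le_imp_le)
qed

text \<open>As \<open>h\<close> takes values in an interval of length 1, the function varies by at
  most \<open>L\<close>, so it stays within \<open>L\<close> of its mean.\<close>

lemma norm_poly_h_minus_integral_le:
  assumes L: "L-lipschitz_on (cball 0 1) (poly p)"
  shows "norm (poly_h p - cscale (L2_integral (poly_h p)) Phi0) \<le> L"
proof -
  define F where "F = (\<lambda>\<omega>. poly p (complex_of_real (h \<omega>)))"
  define c where "c = L2_integral (poly_h p)"
  have c: "c = (\<integral>\<omega>. F \<omega> \<partial>mu)" unfolding c_def F_def by transfer simp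
  have int: "integrable mu F"
    using sq_integrable_mult_cnj[of F "\<lambda>_. 1"] sq_integrable_poly_h[of p] sq_integrable_const[of 1]
    by (simp add: F_def)
  have F_le: "cmod (F \<omega> - F \<eta>) \<le> L" for \<omega> \<eta>
  proof -
    have "cmod (F \<omega> - F \<eta>) \<le> L * dist (complex_of_real (h \<omega>)) (complex_of_real (h \<eta>))"
      using lipschitz_onD[OF L of_real_h_in_cball of_real_h_in_cball] by (simp add: F_def dist_norm)
    also have "dist (complex_of_real (h \<omega>)) (complex_of_real (h \<eta>)) = \<bar>h \<omega> - h \<eta>\<bar>"
      by (simp add: dist_norm flip: of_real_diff)
    also have "L * \<bar>h \<omega> - h \<eta>\<bar> \<le> L * 1"
      using lipschitz_on_nonneg[OF L] h_nonneg[of \<omega>] h_le_1[of \<omega>] h_nonneg[of \<eta>] h_le_1[of \<eta>]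
      by (intro mult_left_mono) auto
    finally show ?thesis by simp
  qed
  have "cmod (F \<omega> - c) \<le> L" for \<omega>
  proof -
    \<comment> \<open>Total mass 1 allows the constant \<open>F \<omega>\<close> to be moved under
      the integral.\<close>
    have "F \<omega> - c = (\<integral>\<eta>. F \<omega> - F \<eta> \<partial>mu)"
      using int using mu.prob_space by (simp add: c)
    also have "cmod \<dots> \<le> (\<integral>\<eta>. cmod (F \<omega> - F \<eta>) \<partial>mu)"
      by (rule integral_norm_bound)
    also have "\<dots> \<le> L"
      using int F_le by (intro mu.integral_le_const) auto
    finally show ?thesis .
  qed
  then have "norm (poly_h (p - [:c:])) \<le> L"
    by (intro norm_poly_h_le) (simp add: F_def)
  then show ?thesis by (simp add: poly_h_diff poly_h_const c_def)
qed

text \<open>All iterates share one integral, and the k-th has Lipschitz constant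
  \<open>L / 2 ^ k\<close>, which therefore bounds its distance from the limit.\<close>

lemma V_S_funpow_tendsto:
  "(\<lambda>k. (V_S ^^ k) (poly_h p)) \<longlonglongrightarrow> cscale (L2_integral (poly_h p)) Phi0"
proof -
  obtain L where "L-lipschitz_on (cball 0 1) (poly p)" by (rule lipschitz_poly_cball)
  then have L: "(L / 2 ^ k)-lipschitz_on (cball 0 1) (poly ((avg_poly ^^ k) p))" for k
    by (induction k) (auto dest: lipschitz_avg_poly simp: mult.commute)
  have bound: "norm ((V_S ^^ k) (poly_h p) - cscale (L2_integral (poly_h p)) Phi0) \<le> L / 2 ^ k" for k
    using norm_poly_h_minus_integral_le[OF L[of k]] L2_integral_V_S_funpow[of k "poly_h p"]
    by (simp add: V_S_funpow_poly_h)
  have "(\<lambda>k. L / 2 ^ k) \<longlonglongrightarrow> 0"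
    using tendsto_mult_right_zero[OF LIMSEQ_power_zero[of "1 / 2 :: real"], of L]
    by (simp add: power_divide)
  then have "(\<lambda>k. (V_S ^^ k) (poly_h p) - cscale (L2_integral (poly_h p)) Phi0) \<longlonglongrightarrow> 0"
    using bound by (rule Lim_null_comparison[OF always_eventually[OF allI], rotated])
  then show ?thesis by (rule LIM_zero_cancel)
qed


section \<open>Convergence in the inductive limit\<close>

text \<open>Being eventually in every set that contains \<open>l\<close> survives finite
  intersections and arbitrary unions, so a subbasis suffices. The first assumption puts
  \<open>l\<close> into the space.\<close>

lemma limitin_topology_generated_by:
  assumes "l \<in> \<Union>\<B>" and "\<And>U. U \<in> \<B> \<Longrightarrow> l \<in> U \<Longrightarrow> eventually (\<lambda>x. f x \<in> U) F"
  shows "limitin (topology_generated_by \<B>) f l F"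
proof -
  have "l \<in> U \<longrightarrow> eventually (\<lambda>x. f x \<in> U) F" if "generate_topology_on \<B> U" for U
    using that
  proof induction
    case (Int a b)
    then show ?case by (auto intro: eventually_conj)
  next
    case (UN K)
    show ?case
    proof
      assume "l \<in> \<Union>K"
      then obtain U where U: "U \<in> K" "l \<in> U" by blast
      with UN.IH have "eventually (\<lambda>x. f x \<in> U) F" by blast
      then show "eventually (\<lambda>x. f x \<in> \<Union>K) F"
        by eventually_elim (use U in blast)
    qed
  qed (use assms in auto)
  with assms(1) show ?thesis
    by (auto simp: limitin_def openin_topology_generated_by_iff)
qed

text \<open>A single generator encodes the indiscrete topology on \<open>X\<close>.\<close>

lemma openin_topology_generated_by_singleton:
  "openin (topology_generated_by {X}) W \<longleftrightarrow> W = {} \<or> W = X"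
proof
  assume "openin (topology_generated_by {X}) W"
  then have "generate_topology_on {X} W" by (simp add: openin_topology_generated_by_iff)
  then show "W = {} \<or> W = X" by induction auto
next
  assume "W = {} \<or> W = X"
  then show "openin (topology_generated_by {X}) W"
    using topology_generated_by_Basis[of X "{X}"] by auto
qed

lemma continuous_map_topology_generated_by_singleton:
  assumes "F ` topspace T \<subseteq> X"
  shows "continuous_map T (topology_generated_by {X}) F"
proof (rule continuous_on_generated_topo)
  fix U assume "U \<in> {X}"
  with assms have "F -` U \<inter> topspace T = topspace T" by blast
  then show "openin T (F -` U \<inter> topspace T)" by simp
qed (use assms in simp)

text \<open>The indiscrete topology is locally convex, so the family of topologies whose supremum is
  taken is nonempty and the inductive limit topology lives on all of \<open>X\<close>.\<close>

lemma locally_convex_indiscrete: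
  assumes zero: "0 \<in> X" and add: "\<And>f g. f \<in> X \<Longrightarrow> g \<in> X \<Longrightarrow> f + g \<in> X"
    and scale: "\<And>c f. f \<in> X \<Longrightarrow> cscale c f \<in> X"
  shows "locally_convex_topology X (topology_generated_by {X})" (is "locally_convex_topology X ?T")
  unfolding locally_convex_topology_def
proof (intro conjI allI impI)
  show "topspace ?T = X" by simp
  show "continuous_map (prod_topology ?T ?T) ?T (\<lambda>(f, g). f + g)"
    by (rule continuous_map_topology_generated_by_singleton) (use add in fastforce)
  show "continuous_map (prod_topology euclidean ?T) ?T (\<lambda>(c, f). cscale c f)"
    by (rule continuous_map_topology_generated_by_singleton) (use scale in fastforce)
  \<comment> \<open>An open set containing 0 is nonempty, hence equal to \<open>X\<close>; so
    \<open>X\<close> itself is the convex neighbourhood sought.\<close>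
  have "convex X"
    unfolding convex_def scaleR_L2_def by (intro ballI allI impI add scale)
  moreover fix W assume "openin ?T W \<and> 0 \<in> W"
  ultimately show "\<exists>C. openin ?T C \<and> convex C \<and> 0 \<in> C \<and> C \<subseteq> W"
    unfolding openin_topology_generated_by_singleton by (intro exI[of _ X]) (use zero in blast)
qed

text \<open>A subbasic set is open in some admissible topology, and continuity of the inclusion of
  \<open>Xn n\<close> carries norm convergence into it. The closure assumptions make the union a
  subspace, so the indiscrete topology is admissible and \<open>l\<close> lies in the space.\<close>

lemma limitin_inductive_limit:
  assumes mem: "\<And>k. s k \<in> Xn n" "l \<in> Xn n" and lim: "s \<longlonglongrightarrow> l"
    and X: "0 \<in> (\<Union>n. Xn n)"
      "\<And>f g. f \<in> (\<Union>n. Xn n) \<Longrightarrow> g \<in> (\<Union>n. Xn n) \<Longrightarrow> f + g \<in> (\<Union>n. Xn n)"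
      "\<And>c f. f \<in> (\<Union>n. Xn n) \<Longrightarrow> cscale c f \<in> (\<Union>n. Xn n)"
  shows "limitin (inductive_limit_topology Xn) s l sequentially"
  unfolding inductive_limit_topology_def
proof (rule limitin_topology_generated_by)
  let ?T = "topology_generated_by {\<Union>n. Xn n}"
  have "continuous_map (top_of_set (Xn n)) ?T (\<lambda>f. f)" for n
    by (rule continuous_map_topology_generated_by_singleton) (simp add: UN_upper)
  moreover have "openin ?T (\<Union>n. Xn n)"
    by (simp add: openin_topology_generated_by_singleton)
  ultimately have "(\<Union>n. Xn n) \<in> {W. \<exists>T. locally_convex_topology (\<Union>n. Xn n) T \<and>
      (\<forall>n. continuous_map (top_of_set (Xn n)) T (\<lambda>f. f)) \<and> openin T W}"
    using locally_convex_indiscrete[OF X] by blast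
  moreover have "l \<in> (\<Union>n. Xn n)" using mem(2) by blast
  ultimately show "l \<in> \<Union> {W. \<exists>T. locally_convex_topology (\<Union>n. Xn n) T \<and>
      (\<forall>n. continuous_map (top_of_set (Xn n)) T (\<lambda>f. f)) \<and> openin T W}"
    by (rule UnionI)
next
  fix U assume "U \<in> {W. \<exists>T. locally_convex_topology (\<Union>n. Xn n) T \<and>
      (\<forall>n. continuous_map (top_of_set (Xn n)) T (\<lambda>f. f)) \<and> openin T W}" and "l \<in> U"
  then obtain T where T: "continuous_map (top_of_set (Xn n)) T (\<lambda>f. f)" "openin T U" by blast
  have "limitin (top_of_set (Xn n)) s l sequentially"
    using mem lim by (simp add: limitin_subtopology)
  from continuous_map_limit[OF T(1) this] have "limitin T s l sequentially"
    by (simp add: o_def)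
  with T(2) \<open>l \<in> U\<close> show "eventually (\<lambda>k. s k \<in> U) sequentially"
    by (simp add: limitin_def)
qed

theorem corollary3p7:
  fixes f :: L2
  assumes "f \<in> polyX"
  shows "limitin polyX_topology (\<lambda>k. (V_S ^^ k) f) (cscale (L2_integral f) Phi0) sequentially"
proof -
  obtain p where p: "f = poly_h p" using assms by (auto simp: polyX_eq)
  show ?thesis unfolding polyX_topology_def
  proof (rule limitin_inductive_limit)
    \<comment> \<open>The whole orbit stays in one finite-dimensional step, fixed by the degree of
      the representative.\<close>
    show "(V_S ^^ k) f \<in> polyX_n (degree p)" for k
      unfolding p V_S_funpow_poly_h polyX_n_eq using degree_avg_poly_funpow_le by blast
    show "cscale (L2_integral f) Phi0 \<in> polyX_n (degree p)"
      unfolding polyX_n_eq poly_h_const[symmetric] by (intro imageI) simp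
    show "(\<lambda>k. (V_S ^^ k) f) \<longlonglongrightarrow> cscale (L2_integral f) Phi0"
      unfolding p by (rule V_S_funpow_tendsto)
    show "0 \<in> (\<Union>n. polyX_n n)"
      unfolding polyX_def[symmetric] polyX_eq poly_h_0[symmetric] by (rule rangeI)
    show "g + g' \<in> (\<Union>n. polyX_n n)" if "g \<in> (\<Union>n. polyX_n n)" "g' \<in> (\<Union>n. polyX_n n)" for g g'
      using that unfolding polyX_def[symmetric] polyX_eq by (auto simp flip: poly_h_add)
    show "cscale c g \<in> (\<Union>n. polyX_n n)" if "g \<in> (\<Union>n. polyX_n n)" for c g
      using that unfolding polyX_def[symmetric] polyX_eq by (auto simp flip: poly_h_smult)
  qed
qed

end
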